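(* Let $I\subseteq\mathbb{R}$ be an interval, $G:I\to(0,1)$ a continuous strictly increasing bijection, and $X,X_1,X_2,\ldots$ i.i.d. with law $P$, $P(I)=1$. Put $U=G(X)$, $U_i=G(X_i)$, and for a fixed integer $q\ge1$ let $\mathbf p_q=(p_1,\ldots,p_q)^\top$ with $p_r=\mathbb{E}[U^r]$ (for all integers $r\geq 1$) and $\widehat{\mathbf p}_q=(\widehat p_1,\ldots,\widehat p_q)^\top$ with $\widehat p_r=\frac1n\sum_{i=1}^nU_i^r$. Then, as $n\to\infty$, $$\sqrt n(\widehat{\mathbf p}_q-\mathbf p_q)\rightsquigarrow\mathcal N_q(0,\Sigma_q),\qquad(\Sigma_q)_{rs}=\operatorname{Cov}(U^r,U^s)=p_{r+s}-p_rp_s,\quad1\le r,s\le q.$$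
   Context: $\mathcal N_q(0,\Sigma)$ is the (possibly degenerate) centred $q$-variate normal law with covariance matrix $\Sigma$. The $p_r$ are called initial coordinate moments. *)

theory Defs
  imports "HOL-Probability.Probability"
begin

text \<open>The transform is given only on the interval.  Extending it by 0 makes it a Borel
  function on the whole line; the value off the interval is seen only on a null set.\<close>
definition ext_coord :: "real set \<Rightarrow> (real \<Rightarrow> real) \<Rightarrow> real \<Rightarrow> real" where
  "ext_coord I G x = (if x \<in> I then G x else 0)"

definition covar :: "'a measure \<Rightarrow> ('a \<Rightarrow> real) \<Rightarrow> ('a \<Rightarrow> real) \<Rightarrow> real" where
  "covar M Y Z = (\<integral>\<omega>. (Y \<omega> - (\<integral>\<omega>'. Y \<omega>' \<partial>M)) * (Z \<omega> - (\<integral>\<omega>'. Z \<omega>' \<partial>M)) \<partial>M)"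

text \<open>Univariate normal law with mean \<open>m\<close> and standard deviation \<open>\<sigma>\<close>; a point mass when
  \<open>\<sigma> = 0\<close>.\<close>
definition normal_law :: "real \<Rightarrow> real \<Rightarrow> real measure" where
  "normal_law m \<sigma> =
     (if \<sigma> = 0 then return borel m else density lborel (\<lambda>x. ennreal (normal_density m \<sigma> x)))"

text \<open>\<open>\<nu>\<close> is the centred normal law with covariance matrix \<open>S\<close>: every linear functional is
  (possibly degenerate) normal, the mean vector is 0 and the coordinate covariances are \<open>S\<close>.\<close>
definition centred_normal_law :: "real ^ 'q ^ 'q \<Rightarrow> (real ^ 'q) measure \<Rightarrow> bool" where
  "centred_normal_law S \<nu> \<longleftrightarrow>
     prob_space \<nu> \<and> sets \<nu> = sets borel \<and>
     (\<forall>t. \<exists>m \<sigma>. 0 \<le> \<sigma> \<and> distr \<nu> borel (\<lambda>x. t \<bullet> x) = normal_law m \<sigma>) \<and>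
     (\<forall>i. (\<integral>x. x $ i \<partial>\<nu>) = 0) \<and>
     (\<forall>i j. covar \<nu> (\<lambda>x. x $ i) (\<lambda>x. x $ j) = S $ i $ j)"

text \<open>Weak convergence of Borel probability measures; \<open>weak_conv_m\<close> of the library covers the
  real line only.\<close>
definition weak_conv_laws :: "(nat \<Rightarrow> 'b::topological_space measure) \<Rightarrow> 'b measure \<Rightarrow> bool" where
  "weak_conv_laws \<mu> \<nu> \<longleftrightarrow>
     (\<forall>f :: 'b \<Rightarrow> real. continuous_on UNIV f \<and> bounded (range f) \<longrightarrow>
        (\<lambda>n. \<integral>x. f x \<partial>\<mu> n) \<longlonglongrightarrow> (\<integral>x. f x \<partial>\<nu>))"

end

theory Submission
  imports Defs
begin

text \<open>
  Fix a linear functional \<open>t\<close>. By the one-dimensional central limit theorem the characteristic function of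
  \<open>t \<bullet> W n\<close>, with \<open>W n\<close> the normalised sum of i.i.d. centred square-integrable vectors, tends to that of
  \<open>N(0, t \<bullet> S t)\<close>; if \<open>t \<bullet> S t = 0\<close> the summands vanish almost surely. A Gaussian vector with these
  one-dimensional projections is obtained by applying a factor of the Gram decomposition of \<open>S\<close>
  (repeated Schur complements) to independent standard normals. The passage from characteristic
  functions to bounded continuous test functions needs no Prokhorov argument: \<open>f\<close> is approximated by a
  trigonometric polynomial with an error of at most \<open>\<epsilon> + 2 B |x|^2 / L^2\<close>, which is uniformly small in
  expectation because the second moments are bounded.
\<close>

subsection \<open>Gram decomposition and univariate normal laws\<close>

lemma quadratic_form_insert:
  fixes S :: "'i \<Rightarrow> 'i \<Rightarrow> real"
  assumes "finite F" "x \<notin> F" and sym: "\<And>i j. S i j = S j i"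
  shows "(\<Sum>i\<in>insert x F. \<Sum>j\<in>insert x F. c i * c j * S i j) =
    c x * c x * S x x + 2 * c x * (\<Sum>j\<in>F. c j * S x j) + (\<Sum>i\<in>F. \<Sum>j\<in>F. c i * c j * S i j)"
proof -
  have "(\<Sum>i\<in>F. c i * c x * S i x) = c x * (\<Sum>j\<in>F. c j * S x j)"
    by (simp add: sum_distrib_left sym[of _ x] mult_ac)
  moreover have "(\<Sum>j\<in>F. c x * c j * S x j) = c x * (\<Sum>j\<in>F. c j * S x j)"
    by (simp add: sum_distrib_left mult_ac)
  ultimately show ?thesis
    using assms(1,2) by (simp add: sum.distrib algebra_simps)
qed

text \<open>Induction on the index set with pivot \<open>x\<close>. Subtracting the rank-one part of
  the pivot leaves the Schur complement \<open>T\<close>, again positive semidefinite; its Gram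
  vectors get one extra coordinate that restores this part. A zero pivot forces its row to vanish,
  and division by zero yielding 0 then keeps all formulas valid.\<close>

lemma psd_imp_gram:
  fixes S :: "'i \<Rightarrow> 'i \<Rightarrow> real"
  assumes "finite F" "\<And>i j. S i j = S j i"
    and "\<And>c. 0 \<le> (\<Sum>i\<in>F. \<Sum>j\<in>F. c i * c j * S i j)"
  shows "\<exists>v. \<forall>i\<in>F. \<forall>j\<in>F. S i j = (\<Sum>k\<in>F. v i k * v j k)"
  using assms
proof (induction F arbitrary: S)
  case empty
  then show ?case by simp
next
  case (insert x F)
  note sym = insert.prems(1) and fin = insert.hyps(1) and xF = insert.hyps(2)
  have expand: "0 \<le> c x * c x * S x x + 2 * c x * (\<Sum>j\<in>F. c j * S x j) +
      (\<Sum>i\<in>F. \<Sum>j\<in>F. c i * c j * S i j)" for c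
    using insert.prems(2)[of c] quadratic_form_insert[OF fin xF sym, of c] by simp
  have Sxx: "0 \<le> S x x"
  proof -
    have "(\<Sum>j\<in>F. (if j = x then 1 else 0) * f j) = 0" for f :: "'i \<Rightarrow> real"
      using xF by (intro sum.neutral) auto
    then show ?thesis
      using expand[of "\<lambda>i. if i = x then 1 else 0"] by (simp add: sum_distrib_left[symmetric] mult.assoc)
  qed
  have zero: "S x y = 0" if "S x x = 0" "y \<in> F" for y
  proof (rule ccontr)
    assume ne: "S x y \<noteq> 0"
    \<comment> \<open>With \<open>S x x = 0\<close> the form is affine in the coordinate
      \<open>x\<close>; this value brings it down to -1.\<close>
    define a where "a = - (S y y + 1) / (2 * S x y)"
    define c where "c i = (if i = x then a else if i = y then 1 else 0)" for i
    have cF: "(\<Sum>j\<in>F. c j * f j) = f y" for f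
    proof -
      have "(\<Sum>j\<in>F. c j * f j) = (\<Sum>j\<in>F. if j = y then f j else 0)"
        using xF by (intro sum.cong) (auto simp: c_def)
      then show ?thesis using fin that(2) by simp
    qed
    have "(\<Sum>i\<in>F. \<Sum>j\<in>F. c i * c j * S i j) = (\<Sum>i\<in>F. c i * (\<Sum>j\<in>F. c j * S i j))"
      by (simp add: sum_distrib_left mult_ac)
    also have "\<dots> = S y y" by (simp add: cF)
    finally have "0 \<le> 2 * a * S x y + S y y"
      using expand[of c] cF[of "S x"] that(1) by (simp add: c_def[of x])
    then show False using ne by (simp add: a_def field_simps)
  qed
  define T where "T i j = S i j - S i x * S j x / S x x" for i j
  have T: "0 \<le> (\<Sum>i\<in>F. \<Sum>j\<in>F. c i * c j * T i j)" for c
  proof -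
    define b where "b = (\<Sum>j\<in>F. c j * S x j)"
    \<comment> \<open>Completing the square: for a positive pivot this coordinate at
      \<open>x\<close> minimises the form of \<open>S\<close>, and the minimum is the form of
      \<open>T\<close>. For a zero pivot it is 0 and \<open>T\<close> agrees with
      \<open>S\<close>.\<close>
    define d where "d i = (if i = x then - b / S x x else c i)" for i
    have d: "d i = c i" if "i \<in> F" for i using that xF by (auto simp: d_def)
    have "b * b = (\<Sum>i\<in>F. \<Sum>j\<in>F. c i * c j * (S i x * S j x))"
      unfolding b_def sum_product sym[of x] by (simp add: mult_ac)
    then have "(\<Sum>i\<in>F. \<Sum>j\<in>F. c i * c j * T i j) =
        (\<Sum>i\<in>F. \<Sum>j\<in>F. c i * c j * S i j) - b * b / S x x"
      by (simp add: T_def right_diff_distrib sum_subtractf sum_divide_distrib)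
    also have "\<dots> = d x * d x * S x x + 2 * d x * (\<Sum>j\<in>F. d j * S x j) +
      (\<Sum>i\<in>F. \<Sum>j\<in>F. d i * d j * S i j)"
      by (simp add: d b_def[symmetric] d_def[of x])
    finally show ?thesis using expand[of d] by simp
  qed
  have "T i j = T j i" for i j by (simp add: T_def sym[of i j])
  from insert.IH[OF this T] obtain v where v: "\<And>i j. i \<in> F \<Longrightarrow> j \<in> F \<Longrightarrow> T i j = (\<Sum>k\<in>F. v i k * v j k)"
    by blast
  \<comment> \<open>One step of a Cholesky factorisation: coordinate \<open>x\<close> carries the
    scaled pivot column, and the vector of \<open>x\<close> has no other component.\<close>
  define w where "w i k = (if k = x then S i x / sqrt (S x x) else if i = x then 0 else v i k)" for i k
  have "S i j = (\<Sum>k\<in>insert x F. w i k * w j k)" if "i \<in> insert x F" "j \<in> insert x F" for i j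
  proof -
    have "(\<Sum>k\<in>insert x F. w i k * w j k) = S i x * S j x / S x x + (\<Sum>k\<in>F. w i k * w j k)"
      using fin xF Sxx by (simp add: w_def)
    also have "(\<Sum>k\<in>F. w i k * w j k) = (if i = x \<or> j = x then 0 else T i j)"
      using that xF v[of i j] by (auto simp: w_def intro!: sum.neutral sum.cong)
    finally show ?thesis
      using that zero[of i] zero[of j] sym[of i x] sym[of j x] by (auto simp: T_def)
  qed
  then show ?case by blast
qed

section \<open>Centred univariate normal laws\<close>

text \<open>Scaling a standard normal variable covers the density and the point mass uniformly, so
  characteristic function and moments can be transported without a case split on
  \<open>\<sigma>\<close>.\<close>

lemma normal_law_0_eq_distr:
  assumes "0 \<le> \<sigma>"
  shows "normal_law 0 \<sigma> = distr std_normal_distribution borel (\<lambda>x. \<sigma> * x)"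
proof (cases "\<sigma> = 0")
  case True
  interpret prob_space std_normal_distribution by (rule prob_space_normal_density) simp
  from True show ?thesis
    by (simp add: normal_law_def distr_const return_def)
next
  case False
  interpret prob_space std_normal_distribution by (rule prob_space_normal_density) simp
  have "distributed std_normal_distribution lborel (\<lambda>x. x) (normal_density 0 1)"
    by (auto simp: distributed_def intro: distr_id2)
  from normal_density_affine[OF this, of \<sigma> 0] False assms
  have "distr std_normal_distribution lborel (\<lambda>x. \<sigma> * x) = normal_law 0 \<sigma>"
    by (simp add: distributed_def normal_law_def)
  then show ?thesis
    by (metis distr_cong sets_lborel)
qed

lemma real_distribution_normal_law:
  "0 \<le> \<sigma> \<Longrightarrow> real_distribution (normal_law 0 \<sigma>)"
proof -
  assume "0 \<le> \<sigma>"
  interpret real_distribution std_normal_distribution by (rule real_dist_normal_dist)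
  show ?thesis using \<open>0 \<le> \<sigma>\<close> by (simp add: normal_law_0_eq_distr real_distribution_distr)
qed

lemma char_distr_scale:
  assumes [measurable]: "X \<in> borel_measurable M"
  shows "char (distr M borel (\<lambda>x. c * X x)) t = char (distr M borel X) (c * t)"
  by (simp add: char_def integral_distr mult_ac)

lemma char_normal_law:
  assumes "0 \<le> \<sigma>"
  shows "char (normal_law 0 \<sigma>) t = exp (- (\<sigma>\<^sup>2 * t\<^sup>2) / 2)"
proof -
  have "char (normal_law 0 \<sigma>) t = char (distr std_normal_distribution borel (\<lambda>x. x)) (\<sigma> * t)"
    unfolding normal_law_0_eq_distr[OF assms] by (rule char_distr_scale) simp
  also have "distr std_normal_distribution borel (\<lambda>x. x) = std_normal_distribution"
    by (rule distr_id2) simp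
  finally show ?thesis by (simp add: char_std_normal_distribution power_mult_distrib)
qed

lemma normal_law_moments:
  assumes "0 \<le> \<sigma>"
  shows integrable_normal_law: "integrable (normal_law 0 \<sigma>) (\<lambda>x. x)"
    and integral_normal_law: "(\<integral>x. x \<partial>normal_law 0 \<sigma>) = 0"
    and integrable_normal_law_square: "integrable (normal_law 0 \<sigma>) (\<lambda>x. x\<^sup>2)"
    and integral_normal_law_square: "(\<integral>x. x\<^sup>2 \<partial>normal_law 0 \<sigma>) = \<sigma>\<^sup>2"
proof -
  define N where "N = std_normal_distribution"
  have "integrable N (\<lambda>x. x ^ 1)" "(\<integral>x. x ^ 1 \<partial>N) = 0"
    "integrable N (\<lambda>x. x\<^sup>2)" "(\<integral>x. x ^ (2 * 1) \<partial>N) = 1"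
    unfolding N_def std_normal_distribution_even_moments(1)
    by (rule integrable_std_normal_distribution_moment integral_std_normal_distribution_moment_odd | simp)+
  then have N: "integrable N (\<lambda>x. \<sigma> * x)" "(\<integral>x. \<sigma> * x \<partial>N) = 0"
    "integrable N (\<lambda>x. (\<sigma> * x)\<^sup>2)" "(\<integral>x. (\<sigma> * x)\<^sup>2 \<partial>N) = \<sigma>\<^sup>2"
    by (simp_all add: power_mult_distrib)
  have m: "(\<lambda>x. \<sigma> * x) \<in> borel_measurable N"
    "(\<lambda>x::real. x) \<in> borel_measurable borel" "(\<lambda>x::real. x\<^sup>2) \<in> borel_measurable borel"
    unfolding N_def by measurable
  show "integrable (normal_law 0 \<sigma>) (\<lambda>x. x)"
    unfolding normal_law_0_eq_distr[OF assms] N_def[symmetric]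
    by (subst integrable_distr_eq) (rule m N)+
  show "(\<integral>x. x \<partial>normal_law 0 \<sigma>) = 0"
    unfolding normal_law_0_eq_distr[OF assms] N_def[symmetric]
    by (subst integral_distr) (rule m N)+
  show "integrable (normal_law 0 \<sigma>) (\<lambda>x. x\<^sup>2)"
    unfolding normal_law_0_eq_distr[OF assms] N_def[symmetric]
    by (subst integrable_distr_eq) (rule m N)+
  show "(\<integral>x. x\<^sup>2 \<partial>normal_law 0 \<sigma>) = \<sigma>\<^sup>2"
    unfolding normal_law_0_eq_distr[OF assms] N_def[symmetric]
    by (subst integral_distr) (rule m N)+
qed

subsection \<open>Weak convergence from characteristic functions\<close>

text \<open>Only linear operations are generators, so convergence of integrals follows by induction
  from the characters; closure under products is derived separately.\<close>

inductive trig_poly :: "('b::real_inner \<Rightarrow> complex) \<Rightarrow> bool" where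
  iexp: "trig_poly (\<lambda>x. iexp (t \<bullet> x))"
| cmult: "trig_poly f \<Longrightarrow> trig_poly (\<lambda>x. c * f x)"
| add: "trig_poly f \<Longrightarrow> trig_poly g \<Longrightarrow> trig_poly (\<lambda>x. f x + g x)"

lemma trig_poly_const: "trig_poly (\<lambda>x. c)"
  using trig_poly.cmult[OF trig_poly.iexp[of 0], of c] by simp

text \<open>Multiplying characters adds their frequencies. This is the base case for products of two
  trigonometric polynomials.\<close>

lemma trig_poly_mult_iexp:
  assumes "trig_poly g"
  shows "trig_poly (\<lambda>x. iexp (t \<bullet> x) * g x)"
  using assms
proof induction
  case (iexp s)
  have "(\<lambda>x. iexp (t \<bullet> x) * iexp (s \<bullet> x)) = (\<lambda>x. iexp ((t + s) \<bullet> x))"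
    by (simp add: inner_add_left exp_add[symmetric] distrib_left)
  then show ?case using trig_poly.iexp[of "t + s"] by metis
next
  case (cmult f c)
  then show ?case using trig_poly.cmult[of _ c] by (simp add: mult.left_commute)
next
  case (add f g)
  then show ?case by (simp add: distrib_left trig_poly.add)
qed

lemma trig_poly_mult:
  assumes "trig_poly f" "trig_poly g"
  shows "trig_poly (\<lambda>x. f x * g x)"
  using assms
proof (induction)
  case (iexp t)
  then show ?case by (simp add: trig_poly_mult_iexp)
next
  case (cmult f c)
  then show ?case using trig_poly.cmult[of _ c] by (simp add: mult.assoc)
next
  case (add f g)
  then show ?case by (simp add: distrib_right trig_poly.add)
qed

lemma trig_poly_sum: "(\<And>i. i \<in> A \<Longrightarrow> trig_poly (f i)) \<Longrightarrow> trig_poly (\<lambda>x. \<Sum>i\<in>A. f i x)"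
  by (induction A rule: infinite_finite_induct) (auto intro: trig_poly_const trig_poly.add)

lemma trig_poly_sin: "trig_poly (\<lambda>x. complex_of_real (sin (t \<bullet> x)))"
proof -
  have "complex_of_real (sin y) = (1 / (2 * \<i>)) * iexp y + (- 1 / (2 * \<i>)) * iexp (- y)" for y
    by (simp add: sin_of_real[symmetric] sin_exp_eq field_simps)
  then have "(\<lambda>x. complex_of_real (sin (t \<bullet> x))) =
      (\<lambda>x. (1 / (2 * \<i>)) * iexp (t \<bullet> x) + (- 1 / (2 * \<i>)) * iexp ((- t) \<bullet> x))"
    by (simp only: inner_minus_left)
  then show ?thesis
    by (simp only: trig_poly.intros)
qed

lemma trig_poly_continuous: "trig_poly g \<Longrightarrow> continuous_on UNIV g"
  by (induction rule: trig_poly.induct) (intro continuous_intros; assumption)+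

lemma trig_poly_bounded: "trig_poly g \<Longrightarrow> \<exists>B. \<forall>x. cmod (g x) \<le> B"
proof (induction rule: trig_poly.induct)
  case (iexp t)
  then show ?case by (intro exI[of _ 1]) simp
next
  case (cmult f c)
  then obtain B where "\<And>x. cmod (f x) \<le> B" by blast
  then show ?case by (intro exI[of _ "cmod c * B"]) (simp add: norm_mult mult_left_mono)
next
  case (add f g)
  then obtain B C where "\<And>x. cmod (f x) \<le> B" "\<And>x. cmod (g x) \<le> C" by blast
  then show ?case by (intro exI[of _ "B + C"]) (auto intro: norm_triangle_mono)
qed

lemma integrable_trig_poly:
  fixes \<mu> :: "'b::euclidean_space measure"
  assumes "prob_space \<mu>" and sets: "sets \<mu> = sets borel" and "trig_poly g"
  shows "integrable \<mu> g"
proof -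
  interpret prob_space \<mu> by fact
  obtain B where "\<And>x. cmod (g x) \<le> B" using trig_poly_bounded[OF assms(3)] by blast
  moreover have "g \<in> borel_measurable \<mu>"
    using borel_measurable_continuous_onI[OF trig_poly_continuous[OF assms(3)]]
    by (simp cong: measurable_cong_sets add: sets)
  ultimately show ?thesis by (intro integrable_const_bound[of _ B]) auto
qed

text \<open>Linear combinations inherit the limit from the characters; boundedness gives the
  integrability needed to split the integral of a sum.\<close>

lemma trig_poly_expectation_tendsto:
  fixes \<mu> :: "nat \<Rightarrow> 'b::euclidean_space measure"
  assumes \<mu>: "\<And>n. prob_space (\<mu> n)" "\<And>n. sets (\<mu> n) = sets borel"
    and \<nu>: "prob_space \<nu>" "sets \<nu> = sets borel"
    and char: "\<And>t. (\<lambda>n. \<integral>x. iexp (t \<bullet> x) \<partial>\<mu> n) \<longlonglongrightarrow> (\<integral>x. iexp (t \<bullet> x) \<partial>\<nu>)"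
    and g: "trig_poly g"
  shows "(\<lambda>n. \<integral>x. g x \<partial>\<mu> n) \<longlonglongrightarrow> (\<integral>x. g x \<partial>\<nu>)"
  using g
proof induction
  case (iexp t)
  show ?case by (rule char)
next
  case (cmult f c)
  then show ?case by (simp add: tendsto_mult_left)
next
  case (add f g)
  then show ?case
    by (simp add: integrable_trig_poly[OF \<mu>] integrable_trig_poly[OF \<nu>] tendsto_add)
qed

section \<open>Approximation by trigonometric polynomials and the weak limit\<close>

text \<open>A linear functional of the vector of sines is a combination of sines with frequencies
  \<open>b /\<^sub>R L\<close>; sums and products of such functions stay trigonometric
  polynomials.\<close>

lemma trig_poly_real_polynomial_sin:
  fixes p :: "'b::euclidean_space \<Rightarrow> real"
  assumes "real_polynomial_function p"
  shows "trig_poly (\<lambda>x. complex_of_real (p (\<Sum>b\<in>Basis. sin ((x \<bullet> b) / L) *\<^sub>R b)))"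
  using assms
proof induction
  case (linear l)
  interpret l: bounded_linear l by fact
  have "trig_poly (\<lambda>x. complex_of_real (l b) * complex_of_real (sin ((b /\<^sub>R L) \<bullet> x)))" for b
    by (intro trig_poly.cmult trig_poly_sin)
  from trig_poly_sum[where A = Basis, OF this]
  show ?case by (simp add: l.sum l.scaleR inner_commute divide_inverse mult_ac)
next
  case (const c)
  show ?case by (rule trig_poly_const)
next
  case (add f g)
  then show ?case by (simp add: trig_poly.add)
next
  case (mult f g)
  then show ?case by (simp add: trig_poly_mult)
qed

text \<open>On the cube \<open>\<bar>x \<bullet> b\<bar> \<le> L\<close> the map \<open>x \<mapsto> (sin (x \<bullet> b / L))\<close> is inverted by \<open>arcsin\<close>, so a
  polynomial approximating \<open>f\<close> in these coordinates on \<open>[-1,1]\<close> is a trigonometric polynomial in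
  \<open>x\<close> that is uniformly bounded off the cube.\<close>
lemma trig_poly_approx:
  fixes f :: "'b::euclidean_space \<Rightarrow> real"
  assumes f: "continuous_on UNIV f" and B: "\<And>x. \<bar>f x\<bar> \<le> B" and "0 < e" "0 < L"
  obtains g where "trig_poly g" "\<And>x. cmod (complex_of_real (f x) - g x) \<le> e + 2 * B * (norm x)\<^sup>2 / L\<^sup>2"
proof -
  define s where "s x = (\<Sum>b\<in>Basis. sin ((x \<bullet> b) / L) *\<^sub>R b)" for x :: 'b
  define a where "a y = (\<Sum>b\<in>Basis. (L * arcsin (y \<bullet> b)) *\<^sub>R b)" for y :: 'b
  have s_cube: "s x \<in> cbox (- One) One" for x
    by (simp add: s_def mem_box inner_sum_left_Basis)
  have "continuous_on (cbox (- One) One) a"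
    unfolding a_def by (intro continuous_intros) (auto simp: mem_box)
  then have "continuous_on (cbox (- One) One) (\<lambda>y. f (a y))"
    by (rule continuous_on_compose2[OF f]) simp
  \<comment> \<open>The function approximated is \<open>f\<close> in arcsine coordinates, continuous
    on the compact cube. Since \<open>s\<close> maps the whole space into this cube, the estimate
    can be used at every \<open>s x\<close>.\<close>
  from Stone_Weierstrass_real_polynomial_function[OF compact_cbox this \<open>0 < e\<close>]
  obtain p where p: "real_polynomial_function p"
    and pe: "\<And>y. y \<in> cbox (- One) One \<Longrightarrow> \<bar>f (a y) - p y\<bar> < e" by blast
  have B0: "0 \<le> B" using B[of 0] by simp
  show ?thesis
  proof
    show "trig_poly (\<lambda>x. complex_of_real (p (s x)))"
      unfolding s_def by (rule trig_poly_real_polynomial_sin[OF p])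
    fix x
    have "\<bar>f x - p (s x)\<bar> \<le> e + 2 * B * (norm x)\<^sup>2 / L\<^sup>2"
    proof (cases "norm x \<le> L")
      case True
      have "arcsin (sin ((x \<bullet> b) / L)) = (x \<bullet> b) / L" if "b \<in> Basis" for b
      proof -
        \<comment> \<open>Since 1 is below pi/2, the argument lies in the range where
          \<open>arcsin\<close> inverts the sine.\<close>
        have "\<bar>(x \<bullet> b) / L\<bar> \<le> 1"
          using Basis_le_norm[OF that, of x] True \<open>0 < L\<close> by simp
        then have "- (pi / 2) \<le> (x \<bullet> b) / L" "(x \<bullet> b) / L \<le> pi / 2"
          using pi_gt3 unfolding abs_le_iff by linarith+
        then show ?thesis by (rule arcsin_sin)
      qed
      then have "a (s x) = x"
        using \<open>0 < L\<close> by (simp add: a_def s_def inner_sum_left_Basis euclidean_representation)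
      then have "\<bar>f x - p (s x)\<bar> \<le> e" using pe[OF s_cube, of x] by simp
      moreover have "0 \<le> 2 * B * (norm x)\<^sup>2 / L\<^sup>2" using B0 by simp
      ultimately show ?thesis by linarith
    next
      case False
      \<comment> \<open>Here \<open>p (s x)\<close> is still within \<open>e\<close> of the value
        \<open>f (a (s x))\<close>, so the error is at most \<open>e + 2 * B\<close>; the quadratic
        factor, being at least 1, absorbs \<open>2 * B\<close>.\<close>
      then have "1 \<le> (norm x)\<^sup>2 / L\<^sup>2" using \<open>0 < L\<close> by (simp add: power_mono)
      then have "2 * B * 1 \<le> 2 * B * ((norm x)\<^sup>2 / L\<^sup>2)" using B0 by (intro mult_left_mono) auto
      then show ?thesis using pe[OF s_cube, of x] B[of x] B[of "a (s x)"] by simp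
    qed
    then show "cmod (complex_of_real (f x) - complex_of_real (p (s x))) \<le> e + 2 * B * (norm x)\<^sup>2 / L\<^sup>2"
      by (metis norm_of_real of_real_diff)
  qed
qed

text \<open>Integrating the pointwise error turns its quadratic part into at most
  \<open>K * C\<close>. The resulting bound depends on \<open>\<mu>\<close> only through the
  second-moment bound \<open>C\<close>.\<close>

lemma norm_integral_diff_le:
  fixes f :: "'b::euclidean_space \<Rightarrow> real"
  assumes \<mu>: "prob_space \<mu>" "sets \<mu> = sets borel"
    and sq: "integrable \<mu> (\<lambda>x. (norm x)\<^sup>2)" "(\<integral>x. (norm x)\<^sup>2 \<partial>\<mu>) \<le> C"
    and f: "continuous_on UNIV f" "\<And>x. \<bar>f x\<bar> \<le> B" and g: "trig_poly g"
    and fg: "\<And>x. cmod (complex_of_real (f x) - g x) \<le> e + K * (norm x)\<^sup>2" and "0 \<le> K"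
  shows "cmod (complex_of_real (\<integral>x. f x \<partial>\<mu>) - (\<integral>x. g x \<partial>\<mu>)) \<le> e + K * C"
proof -
  interpret prob_space \<mu> by fact
  have "f \<in> borel_measurable \<mu>"
    using borel_measurable_continuous_onI[OF f(1)] by (simp cong: measurable_cong_sets add: \<mu>(2))
  then have int_f: "integrable \<mu> f" using f(2) by (intro integrable_const_bound[of _ B]) auto
  note int_g = integrable_trig_poly[OF \<mu> g]
  have "cmod (complex_of_real (\<integral>x. f x \<partial>\<mu>) - (\<integral>x. g x \<partial>\<mu>)) = cmod (\<integral>x. complex_of_real (f x) - g x \<partial>\<mu>)"
    using int_f int_g by simp
  also have "\<dots> \<le> (\<integral>x. cmod (complex_of_real (f x) - g x) \<partial>\<mu>)"
    by (rule integral_norm_bound)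
  also have "\<dots> \<le> (\<integral>x. e + K * (norm x)\<^sup>2 \<partial>\<mu>)"
    using int_f int_g sq by (intro integral_mono fg) auto
  also have "\<dots> = e + K * (\<integral>x. (norm x)\<^sup>2 \<partial>\<mu>)"
    using sq by (simp add: prob_space)
  also have "\<dots> \<le> e + K * C" using sq(2) \<open>0 \<le> K\<close> by (simp add: mult_left_mono)
  finally show ?thesis .
qed

text \<open>Because \<open>C\<close> bounds all second moments, one trigonometric polynomial
  approximates \<open>f\<close> in mean under every \<open>\<mu> n\<close> and under
  \<open>\<nu>\<close>. Only its own integrals then have to converge.\<close>

theorem weak_conv_laws_if_char_tendsto:
  fixes \<mu> :: "nat \<Rightarrow> 'b::euclidean_space measure"
  assumes \<mu>: "\<And>n. prob_space (\<mu> n)" "\<And>n. sets (\<mu> n) = sets borel"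
    and \<nu>: "prob_space \<nu>" "sets \<nu> = sets borel"
    and \<mu>_sq: "\<And>n. integrable (\<mu> n) (\<lambda>x. (norm x)\<^sup>2)" "\<And>n. (\<integral>x. (norm x)\<^sup>2 \<partial>\<mu> n) \<le> C"
    and \<nu>_sq: "integrable \<nu> (\<lambda>x. (norm x)\<^sup>2)" "(\<integral>x. (norm x)\<^sup>2 \<partial>\<nu>) \<le> C"
    and char: "\<And>t. (\<lambda>n. \<integral>x. iexp (t \<bullet> x) \<partial>\<mu> n) \<longlonglongrightarrow> (\<integral>x. iexp (t \<bullet> x) \<partial>\<nu>)"
  shows "weak_conv_laws \<mu> \<nu>"
  unfolding weak_conv_laws_def
proof (intro allI impI, elim conjE)
  fix f :: "'b \<Rightarrow> real"
  assume f: "continuous_on UNIV f" and "bounded (range f)"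
  then obtain B where B: "\<And>x. \<bar>f x\<bar> \<le> B" by (auto simp: bounded_iff)
  have B0: "0 \<le> B" using B[of 0] by simp
  have "0 \<le> (\<integral>x. (norm x)\<^sup>2 \<partial>\<nu>)" by simp
  with \<nu>_sq have C0: "0 \<le> C" by linarith
  show "(\<lambda>n. \<integral>x. f x \<partial>\<mu> n) \<longlonglongrightarrow> (\<integral>x. f x \<partial>\<nu>)"
  proof (rule LIMSEQ_I)
    fix r :: real assume "0 < r"
    \<comment> \<open>Replacing \<open>f\<close> by \<open>g\<close> costs at most
      \<open>2 * e\<close> under each of the two laws and the integrals of \<open>g\<close> differ
      by less than \<open>e\<close>; the total is below \<open>5 * e\<close>, hence below
      \<open>r\<close>.\<close>
    define e where "e = r / 6"
    have e: "0 < e" using \<open>0 < r\<close> by (simp add: e_def)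
    \<comment> \<open>The summand 1 ensures that \<open>L\<close> is positive and at most its
      square, so the square also dominates \<open>2 * B * C / e\<close>.\<close>
    define L where "L = 1 + 2 * B * C / e"
    have L1: "1 \<le> L" using B0 C0 e by (simp add: L_def)
    have "2 * B * C / e \<le> L" by (simp add: L_def)
    also have "\<dots> \<le> L * L" using L1 mult_left_mono[of 1 L L] by simp
    finally have "2 * B * C / e \<le> L * L" .
    then have tail: "2 * B / L\<^sup>2 * C \<le> e"
      using e L1 by (simp add: power2_eq_square field_simps)
    from trig_poly_approx[OF f B e, of L] L1
    obtain g where g: "trig_poly g"
      "\<And>x. cmod (complex_of_real (f x) - g x) \<le> e + 2 * B * (norm x)\<^sup>2 / L\<^sup>2"
      by auto
    have fg: "cmod (complex_of_real (f x) - g x) \<le> e + 2 * B / L\<^sup>2 * (norm x)\<^sup>2" for x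
      using g(2)[of x] by simp
    have K: "0 \<le> 2 * B / L\<^sup>2" using B0 by simp
    have 1: "cmod (complex_of_real (\<integral>x. f x \<partial>\<mu> n) - (\<integral>x. g x \<partial>\<mu> n)) \<le> 2 * e" for n
      using norm_integral_diff_le[OF \<mu>(1,2) \<mu>_sq f B g(1) fg K, of n] tail by linarith
    have 2: "cmod (complex_of_real (\<integral>x. f x \<partial>\<nu>) - (\<integral>x. g x \<partial>\<nu>)) \<le> 2 * e"
      using norm_integral_diff_le[OF \<nu>(1,2) \<nu>_sq f B g(1) fg K] tail by linarith
    obtain N where N: "\<And>n. n \<ge> N \<Longrightarrow> cmod ((\<integral>x. g x \<partial>\<mu> n) - (\<integral>x. g x \<partial>\<nu>)) < e"
      using LIMSEQ_D[OF trig_poly_expectation_tendsto[OF \<mu> \<nu> char g(1)] e] by blast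
    have "norm ((\<integral>x. f x \<partial>\<mu> n) - (\<integral>x. f x \<partial>\<nu>)) < r" if "n \<ge> N" for n
    proof -
      let ?a = "complex_of_real (\<integral>x. f x \<partial>\<mu> n)" and ?b = "complex_of_real (\<integral>x. f x \<partial>\<nu>)"
      let ?u = "\<integral>x. g x \<partial>\<mu> n" and ?v = "\<integral>x. g x \<partial>\<nu>"
      have "cmod (?a - ?b) = cmod ((?a - ?u) + (?u - ?v) + (?v - ?b))" by simp
      also have "\<dots> \<le> cmod (?a - ?u) + cmod (?u - ?v) + cmod (?b - ?v)"
        by (intro norm_triangle_mono) (simp_all add: norm_minus_commute)
      also have "\<dots> < r" using 1[of n] 2 N[OF that] e by (simp add: e_def)
      finally show ?thesis by (simp only: of_real_diff[symmetric] norm_of_real real_norm_def)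
    qed
    then show "\<exists>N. \<forall>n\<ge>N. norm ((\<integral>x. f x \<partial>\<mu> n) - (\<integral>x. f x \<partial>\<nu>)) < r" by blast
  qed
qed

subsection \<open>Multivariate normal laws\<close>

lemma inner_matrix_vector_mult:
  fixes S :: "real ^ 'q ^ 'q"
  shows "t \<bullet> (S *v t) = (\<Sum>i\<in>UNIV. \<Sum>j\<in>UNIV. t $ i * t $ j * S $ i $ j)"
  by (simp add: inner_vec_def matrix_vector_mult_def sum_distrib_left mult_ac)

text \<open>The joint law of the coordinate maps is the product measure itself, hence the product of
  their marginals, which characterises independence.\<close>

lemma indep_vars_PiM_components:
  assumes "\<And>i. real_distribution (N i)"
  shows "prob_space.indep_vars (PiM UNIV N) (\<lambda>_. borel) (\<lambda>i g. g i) UNIV"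
    and "distr (PiM UNIV N) borel (\<lambda>g. g i) = N i"
proof -
  interpret N: real_distribution "N i" for i by fact
  interpret P: prob_space "PiM UNIV N" by (intro prob_space_PiM N.prob_space_axioms)
  show comp: "distr (PiM UNIV N) borel (\<lambda>g. g i) = N i" for i
  proof -
    have "distr (PiM UNIV N) borel (\<lambda>g. g i) = distr (PiM UNIV N) (N i) (\<lambda>g. g i)"
      by (rule distr_cong) simp_all
    also have "\<dots> = N i" by (rule distr_PiM_component) (simp_all add: N.prob_space_axioms)
    finally show ?thesis .
  qed
  have meas: "(\<lambda>g. g i) \<in> borel_measurable (PiM UNIV N)" for i
    using measurable_component_singleton[of i UNIV N] by (simp cong: measurable_cong_sets)
  have "distr (PiM UNIV N) (PiM UNIV (\<lambda>_. borel)) (\<lambda>x. x) = PiM UNIV N"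
    by (rule distr_id2) (auto intro!: sets_PiM_cong)
  then show "P.indep_vars (\<lambda>_. borel) (\<lambda>i g. g i) UNIV"
    by (subst P.indep_vars_iff_distr_eq_PiM) (simp_all add: meas comp restrict_def)
qed

lemma borel_measurable_vec_lambda:
  fixes f :: "'q::finite \<Rightarrow> 'a \<Rightarrow> real"
  assumes "\<And>i. f i \<in> borel_measurable M"
  shows "(\<lambda>x. \<chi> i. f i x) \<in> borel_measurable M"
  using assms by (subst borel_measurable_euclidean_space) (auto simp: Basis_vec_def inner_axis)

text \<open>If \<open>v\<close> are Gram vectors of \<open>S\<close>, applying the matrix
  \<open>v\<close> to independent standard normals gives covariance \<open>S\<close>. Each
  functional is a linear combination of these normals, whose variance is the sum of the squared
  coefficients.\<close>

lemma gaussian_exists: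
  fixes S :: "real ^ 'q ^ 'q"
  assumes sym: "\<And>i j. S $ i $ j = S $ j $ i" and psd: "\<And>t. 0 \<le> t \<bullet> (S *v t)"
  obtains \<nu> :: "(real ^ 'q) measure" where "prob_space \<nu>" "sets \<nu> = sets borel"
    "\<And>t. distr \<nu> borel (\<lambda>x. t \<bullet> x) = normal_law 0 (sqrt (t \<bullet> (S *v t)))"
proof -
  have "0 \<le> (\<Sum>i\<in>UNIV. \<Sum>j\<in>UNIV. c i * c j * S $ i $ j)" for c
    using psd[of "\<chi> i. c i"] by (simp add: inner_matrix_vector_mult)
  from psd_imp_gram[OF finite_class.finite_UNIV, of "\<lambda>i j. S $ i $ j", OF sym this]
  obtain v :: "'q \<Rightarrow> 'q \<Rightarrow> real" where "\<forall>i\<in>UNIV. \<forall>j\<in>UNIV. S $ i $ j = (\<Sum>k\<in>UNIV. v i k * v j k)" ..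
  then have v: "S $ i $ j = (\<Sum>k\<in>UNIV. v i k * v j k)" for i j by blast
  define N where "N = std_normal_distribution"
  interpret N: real_distribution N unfolding N_def by (rule real_dist_normal_dist)
  define W where "W = PiM UNIV (\<lambda>_::'q. N)"
  interpret W: prob_space W unfolding W_def by (intro prob_space_PiM N.prob_space_axioms)
  have indep: "W.indep_vars (\<lambda>_. borel) (\<lambda>k g. g k) UNIV"
    and comp: "distr W borel (\<lambda>g. g k) = N" for k
    unfolding W_def by (rule indep_vars_PiM_components; rule N.real_distribution_axioms)+
  have meas: "(\<lambda>g. g k) \<in> borel_measurable W" for k
    using indep by (simp add: W.indep_vars_def)
  define X where "X g = (\<chi> i. \<Sum>k\<in>UNIV. v i k * g k)" for g :: "'q \<Rightarrow> real"
  have X: "X \<in> borel_measurable W"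
    unfolding X_def using meas by (intro borel_measurable_vec_lambda) simp
  show ?thesis
  proof
    show "prob_space (distr W borel X)" by (rule W.prob_space_distr[OF X])
    show "sets (distr W borel X) = sets borel" by simp
    fix t :: "real ^ 'q"
    \<comment> \<open>The transpose of \<open>v\<close> applied to \<open>t\<close>: the
      coefficients of \<open>t \<bullet> X g\<close> in the independent normals.\<close>
    define c where "c k = (\<Sum>i\<in>UNIV. t $ i * v i k)" for k
    have tX: "t \<bullet> X g = (\<Sum>k\<in>UNIV. c k * g k)" for g
    proof -
      have "t \<bullet> X g = (\<Sum>i\<in>UNIV. \<Sum>k\<in>UNIV. t $ i * (v i k * g k))"
        by (simp add: X_def inner_vec_def sum_distrib_left)
      also have "\<dots> = (\<Sum>k\<in>UNIV. \<Sum>i\<in>UNIV. t $ i * (v i k * g k))" by (rule sum.swap)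
      finally show ?thesis by (simp add: c_def sum_distrib_right mult.assoc)
    qed
    have var: "t \<bullet> (S *v t) = (\<Sum>k\<in>UNIV. (c k)\<^sup>2)"
    proof -
      have "t \<bullet> (S *v t) = (\<Sum>i\<in>UNIV. \<Sum>j\<in>UNIV. \<Sum>k\<in>UNIV. (t $ i * v i k) * (t $ j * v j k))"
        by (simp add: inner_matrix_vector_mult v sum_distrib_left mult_ac)
      also have "\<dots> = (\<Sum>i\<in>UNIV. \<Sum>k\<in>UNIV. \<Sum>j\<in>UNIV. (t $ i * v i k) * (t $ j * v j k))"
        by (intro sum.cong refl sum.swap)
      also have "\<dots> = (\<Sum>k\<in>UNIV. \<Sum>i\<in>UNIV. \<Sum>j\<in>UNIV. (t $ i * v i k) * (t $ j * v j k))"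
        by (rule sum.swap)
      finally show ?thesis by (simp add: c_def power2_eq_square sum_product)
    qed
    let ?\<sigma> = "sqrt (t \<bullet> (S *v t))"
    have \<sigma>: "0 \<le> ?\<sigma>" using psd by simp
    have m: "(\<lambda>g. t \<bullet> X g) \<in> borel_measurable W" using X by measurable
    have "distr (distr W borel X) borel (\<lambda>x. t \<bullet> x) = distr W borel (\<lambda>g. t \<bullet> X g)"
      using X by (subst distr_distr) (simp_all add: comp_def)
    also have "\<dots> = normal_law 0 ?\<sigma>"
    \<comment> \<open>Comparing characteristic functions also covers functionals of variance 0,
      where no density exists.\<close>
    proof (rule Levy_uniqueness)
      show "real_distribution (distr W borel (\<lambda>g. t \<bullet> X g))"
        using m by (rule W.real_distribution_distr)
      show "real_distribution (normal_law 0 ?\<sigma>)"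
        using \<sigma> by (rule real_distribution_normal_law)
      show "char (distr W borel (\<lambda>g. t \<bullet> X g)) = char (normal_law 0 ?\<sigma>)"
      proof
        fix s
        have "W.indep_vars (\<lambda>_. borel) (\<lambda>k g. c k * g k) UNIV"
          using indep by (rule W.indep_vars_compose2) simp
        then have "char (distr W borel (\<lambda>g. t \<bullet> X g)) s =
            (\<Prod>k\<in>UNIV. char (distr W borel (\<lambda>g. c k * g k)) s)"
          unfolding tX by (rule W.char_distr_sum)
        also have "\<dots> = (\<Prod>k\<in>UNIV. char N (c k * s))"
          by (simp only: char_distr_scale[OF meas] comp)
        also have "\<dots> = (\<Prod>k\<in>UNIV. complex_of_real (exp (- ((c k * s)\<^sup>2) / 2)))"
          by (simp only: N_def char_std_normal_distribution)
        also have "\<dots> = complex_of_real (exp (\<Sum>k\<in>UNIV. - ((c k * s)\<^sup>2) / 2))"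
          by (simp only: exp_sum[OF finite_class.finite_UNIV] of_real_prod)
        also have "(\<Sum>k\<in>UNIV. - ((c k * s)\<^sup>2) / 2) = - (?\<sigma>\<^sup>2 * s\<^sup>2) / 2"
          using psd[of t] by (simp add: var power_mult_distrib sum_negf sum_distrib_right sum_divide_distrib)
        finally show "char (distr W borel (\<lambda>g. t \<bullet> X g)) s = char (normal_law 0 ?\<sigma>) s"
          by (simp only: char_normal_law[OF \<sigma>])
      qed
    qed
    finally show "distr (distr W borel X) borel (\<lambda>x. t \<bullet> x) = normal_law 0 ?\<sigma>" .
  qed
qed

lemma gaussian_functional_moments:
  fixes \<nu> :: "'b::euclidean_space measure"
  assumes "sets \<nu> = sets borel" and t: "distr \<nu> borel (\<lambda>x. t \<bullet> x) = normal_law 0 (sqrt v)" and "0 \<le> v"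
  shows "integrable \<nu> (\<lambda>x. t \<bullet> x)" "(\<integral>x. t \<bullet> x \<partial>\<nu>) = 0"
    "integrable \<nu> (\<lambda>x. (t \<bullet> x)\<^sup>2)" "(\<integral>x. (t \<bullet> x)\<^sup>2 \<partial>\<nu>) = v"
proof -
  have m: "(\<lambda>x. t \<bullet> x) \<in> borel_measurable \<nu>"
    using assms(1) by (simp cong: measurable_cong_sets)
  have \<sigma>: "0 \<le> sqrt v" using \<open>0 \<le> v\<close> by simp
  show "integrable \<nu> (\<lambda>x. t \<bullet> x)"
    using integrable_normal_law[OF \<sigma>] unfolding t[symmetric] by (subst (asm) integrable_distr_eq[OF m]) auto
  show "(\<integral>x. t \<bullet> x \<partial>\<nu>) = 0"
    using integral_normal_law[OF \<sigma>] unfolding t[symmetric] by (subst (asm) integral_distr[OF m]) auto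
  show "integrable \<nu> (\<lambda>x. (t \<bullet> x)\<^sup>2)"
    using integrable_normal_law_square[OF \<sigma>] unfolding t[symmetric] by (subst (asm) integrable_distr_eq[OF m]) auto
  show "(\<integral>x. (t \<bullet> x)\<^sup>2 \<partial>\<nu>) = v"
    using integral_normal_law_square[OF \<sigma>] \<open>0 \<le> v\<close> unfolding t[symmetric] by (subst (asm) integral_distr[OF m]) auto
qed

text \<open>Polarisation: the functionals \<open>axis i 1\<close>, \<open>axis j 1\<close> and their
  sum have variances from which the mixed moment of coordinates \<open>i\<close> and
  \<open>j\<close> is recovered.\<close>

lemma centred_normal_law_if_functionals:
  fixes S :: "real ^ 'q ^ 'q" and \<nu> :: "(real ^ 'q) measure"
  assumes sym: "\<And>i j. S $ i $ j = S $ j $ i" and psd: "\<And>t. 0 \<le> t \<bullet> (S *v t)"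
    and \<nu>: "prob_space \<nu>" "sets \<nu> = sets borel"
    and law: "\<And>t. distr \<nu> borel (\<lambda>x. t \<bullet> x) = normal_law 0 (sqrt (t \<bullet> (S *v t)))"
  shows "centred_normal_law S \<nu>"
proof -
  note mom = gaussian_functional_moments[OF \<nu>(2) law psd]
  have ax: "axis i 1 \<bullet> x = x $ i" for i and x :: "real ^ 'q"
    by (simp add: inner_axis' )
  have mean: "(\<integral>x. x $ i \<partial>\<nu>) = 0" for i
    using mom(2)[of "axis i 1"] by (simp add: ax)
  have q: "(S *v axis j 1) $ i = S $ i $ j" for i j
    by (simp add: matrix_vector_mult_basis column_def)
  have sq: "integrable \<nu> (\<lambda>x. (x $ i)\<^sup>2)" "(\<integral>x. (x $ i)\<^sup>2 \<partial>\<nu>) = S $ i $ i" for i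
    using mom(3,4)[of "axis i 1"] by (simp_all add: ax q)
  have sum_sq: "integrable \<nu> (\<lambda>x. (x $ i + x $ j)\<^sup>2)"
    "(\<integral>x. (x $ i + x $ j)\<^sup>2 \<partial>\<nu>) = S $ i $ i + 2 * S $ i $ j + S $ j $ j" for i j
    using mom(3,4)[of "axis i 1 + axis j 1"] sym[of j i]
    by (simp_all add: ax q inner_add_left inner_add_right matrix_vector_right_distrib)
  have "(\<integral>x. x $ i * x $ j \<partial>\<nu>) = S $ i $ j" for i j
  proof -
    have "(\<lambda>x :: real ^ 'q. x $ i * x $ j) = (\<lambda>x. ((x $ i + x $ j)\<^sup>2 - (x $ i)\<^sup>2 - (x $ j)\<^sup>2) / 2)"
      by (simp add: fun_eq_iff power2_eq_square algebra_simps)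
    then show ?thesis
      using sq sum_sq by simp
  qed
  moreover have "\<exists>m \<sigma>. 0 \<le> \<sigma> \<and> distr \<nu> borel (\<lambda>x. t \<bullet> x) = normal_law m \<sigma>" for t
    using law[of t] psd[of t] by (intro exI[of _ 0] exI[of _ "sqrt (t \<bullet> (S *v t))"]) simp
  ultimately show ?thesis
    using \<nu> by (simp add: centred_normal_law_def covar_def mean)
qed

subsection \<open>The multivariate central limit theorem\<close>

lemma (in prob_space) indep_vars_inj_reindex:
  assumes indep: "indep_vars (\<lambda>_. N) X UNIV" and "inj f"
  shows "indep_vars (\<lambda>_. N) (\<lambda>i. X (f i)) UNIV"
proof -
  let ?F = "\<lambda>i. {X i -` A \<inter> space M |A. A \<in> sets N}"
  have rv: "\<And>i. X i \<in> measurable M N" and sets: "indep_sets ?F UNIV"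
    using indep by (auto simp: indep_vars_def2)
  have "indep_sets (\<lambda>i. ?F (f i)) UNIV"
  proof (rule indep_setsI)
    show "?F (f i) \<subseteq> events" for i using rv by (auto intro: measurable_sets)
    fix A J
    assume J: "J \<noteq> {}" "finite J" "\<forall>j\<in>J. A j \<in> ?F (f j)"
    have inv: "inv_into UNIV f (f j) = j" for j using \<open>inj f\<close> by simp
    define B where "B k = A (inv_into UNIV f k)" for k
    have "\<forall>k\<in>f ` J. B k \<in> ?F k" using J(3) by (auto simp: B_def inv)
    then have "prob (\<Inter>k\<in>f ` J. B k) = (\<Prod>k\<in>f ` J. prob (B k))"
      using J by (intro indep_setsD[OF sets]) auto
    moreover have "(\<Inter>k\<in>f ` J. B k) = (\<Inter>j\<in>J. A j)" by (simp add: B_def inv)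
    moreover have "(\<Prod>k\<in>f ` J. prob (B k)) = (\<Prod>j\<in>J. prob (A j))"
      using inj_on_subset[OF \<open>inj f\<close>] by (subst prod.reindex) (auto simp: B_def inv)
    ultimately show "prob (\<Inter>j\<in>J. A j) = (\<Prod>j\<in>J. prob (A j))" by simp
  qed
  then show ?thesis using rv by (simp add: indep_vars_def2)
qed

lemma (in prob_space) integrable_mult_if_square:
  fixes X Y :: "'a \<Rightarrow> real"
  assumes "X \<in> borel_measurable M" "Y \<in> borel_measurable M"
    and "integrable M (\<lambda>\<omega>. (X \<omega>)\<^sup>2)" "integrable M (\<lambda>\<omega>. (Y \<omega>)\<^sup>2)"
  shows "integrable M (\<lambda>\<omega>. X \<omega> * Y \<omega>)"
proof (rule Bochner_Integration.integrable_bound)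
  show "integrable M (\<lambda>\<omega>. (X \<omega>)\<^sup>2 + (Y \<omega>)\<^sup>2)" using assms by simp
  have "\<bar>x * y\<bar> \<le> x\<^sup>2 + y\<^sup>2" for x y :: real
    using sum_squares_bound[of "\<bar>x\<bar>" "\<bar>y\<bar>"] abs_ge_zero[of "x * y"] unfolding abs_mult power2_abs by linarith
  then show "AE \<omega> in M. norm (X \<omega> * Y \<omega>) \<le> norm ((X \<omega>)\<^sup>2 + (Y \<omega>)\<^sup>2)" by simp
qed (use assms in simp)

text \<open>In the expanded square the cross term vanishes: the new summand is centred and
  independent of the preceding sum.\<close>

lemma (in prob_space) sum_indep_square:
  fixes Z :: "nat \<Rightarrow> 'a \<Rightarrow> real"
  assumes indep: "indep_vars (\<lambda>_. borel) Z UNIV"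
    and mean: "\<And>i. expectation (Z i) = 0"
    and sq: "\<And>i. integrable M (\<lambda>\<omega>. (Z i \<omega>)\<^sup>2)" "\<And>i. expectation (\<lambda>\<omega>. (Z i \<omega>)\<^sup>2) = v"
  shows "integrable M (\<lambda>\<omega>. (\<Sum>i<n. Z i \<omega>)\<^sup>2) \<and> expectation (\<lambda>\<omega>. (\<Sum>i<n. Z i \<omega>)\<^sup>2) = n * v"
proof (induction n)
  case 0
  show ?case by simp
next
  case (Suc n)
  have Z: "Z i \<in> borel_measurable M" for i using indep by (simp add: indep_vars_def)
  have int: "integrable M (Z i)" for i
    by (rule square_integrable_imp_integrable[OF Z sq(1)])
  have "indep_vars (\<lambda>_. borel) Z (insert n {..<n})" by (rule indep_vars_subset[OF indep]) simp
  then have ind: "indep_var borel (Z n) borel (\<lambda>\<omega>. \<Sum>i<n. Z i \<omega>)"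
    by (intro indep_vars_sum) auto
  have cross: "integrable M (\<lambda>\<omega>. Z n \<omega> * (\<Sum>i<n. Z i \<omega>))"
    "expectation (\<lambda>\<omega>. Z n \<omega> * (\<Sum>i<n. Z i \<omega>)) = 0"
    using indep_var_integrable[OF ind int] indep_var_lebesgue_integral[OF ind int] int
    by (simp_all add: mean)
  have "(\<lambda>\<omega>. (\<Sum>i<Suc n. Z i \<omega>)\<^sup>2) =
      (\<lambda>\<omega>. (\<Sum>i<n. Z i \<omega>)\<^sup>2 + 2 * (Z n \<omega> * (\<Sum>i<n. Z i \<omega>)) + (Z n \<omega>)\<^sup>2)"
    by (simp add: fun_eq_iff power2_eq_square algebra_simps)
  then show ?case
    using Suc.IH cross sq[of n] by (simp add: algebra_simps)
qed

text \<open>For positive \<open>\<sigma>\<close> this is the scalar central limit theorem followed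
  by Levy continuity; for \<open>\<sigma> = 0\<close> both characteristic functions are constantly
  1.\<close>

lemma (in prob_space) char_sum_tendsto_normal:
  fixes Z :: "nat \<Rightarrow> 'a \<Rightarrow> real"
  assumes indep: "indep_vars (\<lambda>_. borel) Z UNIV" and law: "\<And>i. distr M borel (Z i) = \<mu>"
    and mean: "\<And>i. expectation (Z i) = 0"
    and sq: "\<And>i. integrable M (\<lambda>\<omega>. (Z i \<omega>)\<^sup>2)" "\<And>i. expectation (\<lambda>\<omega>. (Z i \<omega>)\<^sup>2) = \<sigma>\<^sup>2"
    and "0 \<le> \<sigma>"
  shows "(\<lambda>n. char (distr M borel (\<lambda>\<omega>. (\<Sum>i<n. Z i \<omega>) / sqrt n)) s) \<longlonglongrightarrow> char (normal_law 0 \<sigma>) s"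
proof -
  have Z [measurable]: "Z i \<in> borel_measurable M" for i using indep by (simp add: indep_vars_def)
  then have m: "(\<lambda>\<omega>. \<Sum>i<n. Z i \<omega>) \<in> borel_measurable M" for n by simp
  show ?thesis
  proof (cases "\<sigma> = 0")
    case True
    have "AE \<omega> in M. Z i \<omega> = 0" for i
      using sq[of i] integral_nonneg_eq_0_iff_AE[OF sq(1)[of i]] True by simp
    \<comment> \<open>A countable union of null sets is null, so every partial sum vanishes outside
      one null set.\<close>
    then have "AE \<omega> in M. \<forall>i. Z i \<omega> = 0" by (simp add: AE_all_countable)
    then have "AE \<omega> in M. iexp (s * ((\<Sum>i<n. Z i \<omega>) / sqrt n)) = 1" for n
      by eventually_elim simp
    then have "(\<integral>\<omega>. iexp (s * ((\<Sum>i<n. Z i \<omega>) / sqrt n)) \<partial>M) = (\<integral>\<omega>. 1 \<partial>M)" for n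
      using m by (intro integral_cong_AE) auto
    then have "char (distr M borel (\<lambda>\<omega>. (\<Sum>i<n. Z i \<omega>) / sqrt n)) s = 1" for n
      using m by (simp add: char_def integral_distr prob_space)
    then show ?thesis using True by (simp add: char_normal_law)
  next
    case False
    with \<open>0 \<le> \<sigma>\<close> have \<sigma>: "0 < \<sigma>" by simp
    have "weak_conv_m (\<lambda>n. distr M borel (\<lambda>\<omega>. (\<Sum>i<n. Z i \<omega>) / sqrt (n * \<sigma>\<^sup>2))) std_normal_distribution"
      using \<sigma> sq mean by (intro central_limit_theorem_zero_mean[OF indep _ \<sigma> _ _ law]) simp_all
    \<comment> \<open>Evaluation at \<open>\<sigma> * s\<close> undoes the standardisation by
      \<open>\<sigma>\<close>.\<close>
    then have lim: "(\<lambda>n. char (distr M borel (\<lambda>\<omega>. (\<Sum>i<n. Z i \<omega>) / sqrt (n * \<sigma>\<^sup>2))) (\<sigma> * s))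
        \<longlonglongrightarrow> char std_normal_distribution (\<sigma> * s)"
      using m by (intro levy_continuity1 real_dist_normal_dist real_distribution_distr) simp_all
    have "char (distr M borel (\<lambda>\<omega>. (\<Sum>i<n. Z i \<omega>) / sqrt (n * \<sigma>\<^sup>2))) (\<sigma> * s) =
        char (distr M borel (\<lambda>\<omega>. (\<Sum>i<n. Z i \<omega>) / sqrt n)) s" for n
    proof -
      have "(\<lambda>\<omega>. (\<Sum>i<n. Z i \<omega>) / sqrt (n * \<sigma>\<^sup>2)) = (\<lambda>\<omega>. (1 / \<sigma>) * ((\<Sum>i<n. Z i \<omega>) / sqrt n))"
        using \<sigma> by (simp add: real_sqrt_mult mult.commute)
      moreover have "(\<lambda>\<omega>. (\<Sum>i<n. Z i \<omega>) / sqrt n) \<in> borel_measurable M" using m by simp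
      ultimately show ?thesis using \<sigma> by (simp only: char_distr_scale) simp
    qed
    moreover have "char std_normal_distribution (\<sigma> * s) = char (normal_law 0 \<sigma>) s"
      by (simp only: char_std_normal_distribution char_normal_law[OF \<open>0 \<le> \<sigma>\<close>] power_mult_distrib)
    ultimately show ?thesis using lim by simp
  qed
qed

text \<open>The Cramer-Wold reduction: \<open>t \<bullet> W n\<close> is a normalised sum of i.i.d.
  centred real variables, so the scalar limit gives the joint characteristic function at
  \<open>t\<close>. Centring makes the matrix of mixed moments the covariance matrix.\<close>

theorem (in prob_space) multivariate_central_limit_theorem:
  fixes Y :: "nat \<Rightarrow> 'a \<Rightarrow> real ^ 'q"
  assumes indep: "indep_vars (\<lambda>_. borel) Y UNIV" and law: "\<And>i. distr M borel (Y i) = \<mu>"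
    and mean: "\<And>k. expectation (\<lambda>\<omega>. Y 0 \<omega> $ k) = 0"
    and sq: "\<And>k. integrable M (\<lambda>\<omega>. (Y 0 \<omega> $ k)\<^sup>2)"
  shows "\<exists>\<nu>. centred_normal_law (\<chi> i j. expectation (\<lambda>\<omega>. Y 0 \<omega> $ i * Y 0 \<omega> $ j)) \<nu> \<and>
    weak_conv_laws (\<lambda>n. distr M borel (\<lambda>\<omega>. (1 / sqrt n) *\<^sub>R (\<Sum>i<n. Y i \<omega>))) \<nu>"
proof -
  define S where "S = (\<chi> i j. expectation (\<lambda>\<omega>. Y 0 \<omega> $ i * Y 0 \<omega> $ j))"
  have Y: "Y i \<in> borel_measurable M" for i using indep by (simp add: indep_vars_def)
  have nth: "(\<lambda>x :: real ^ 'q. x $ k) \<in> borel_measurable borel" for k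
    by (intro borel_measurable_continuous_onI continuous_intros)
  have Yk: "(\<lambda>\<omega>. Y i \<omega> $ k) \<in> borel_measurable M" for i k
    using measurable_compose[OF Y nth] .
  have prod: "integrable M (\<lambda>\<omega>. Y 0 \<omega> $ i * Y 0 \<omega> $ j)" for i j
    by (intro integrable_mult_if_square Yk sq)
  have int: "integrable M (\<lambda>\<omega>. Y 0 \<omega> $ k)" for k
    by (rule square_integrable_imp_integrable[OF Yk sq])
  have tY_sq: "(t \<bullet> Y 0 \<omega>)\<^sup>2 = (\<Sum>i\<in>UNIV. \<Sum>j\<in>UNIV. t $ i * t $ j * (Y 0 \<omega> $ i * Y 0 \<omega> $ j))" for t \<omega>
    by (simp add: inner_vec_def power2_eq_square sum_product mult_ac)
  have int0: "integrable M (\<lambda>\<omega>. (t \<bullet> Y 0 \<omega>)\<^sup>2)" for t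
    unfolding tY_sq using prod by simp
  have var0: "expectation (\<lambda>\<omega>. (t \<bullet> Y 0 \<omega>)\<^sup>2) = t \<bullet> (S *v t)" for t
    unfolding tY_sq inner_matrix_vector_mult using prod by (simp add: S_def)
  have mean0: "expectation (\<lambda>\<omega>. t \<bullet> Y 0 \<omega>) = 0" for t
    unfolding inner_vec_def using int by (simp add: mean)
  have psd: "0 \<le> t \<bullet> (S *v t)" for t unfolding var0[symmetric] by simp
  have sym: "S $ i $ j = S $ j $ i" for i j by (simp add: S_def mult.commute)

  define Z where "Z t i = (\<lambda>\<omega>. t \<bullet> Y i \<omega>)" for t i
  have Z_m: "Z t i \<in> borel_measurable M" for t i unfolding Z_def using Y by simp
  have Z_indep: "indep_vars (\<lambda>_. borel) (Z t) UNIV" for t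
    unfolding Z_def by (rule indep_vars_compose2[OF indep]) simp
  have Z_law: "distr M borel (Z t i) = distr \<mu> borel (\<lambda>x. t \<bullet> x)" for t i
    unfolding law[of i, symmetric] using Y by (subst distr_distr) (simp_all add: comp_def Z_def)
  \<comment> \<open>Moments are known for index 0 only; the common law carries them to every
    index.\<close>
  have Z_sq: "integrable M (\<lambda>\<omega>. (Z t i \<omega>)\<^sup>2)" for t i
  proof -
    have "integrable (distr M borel (Z t 0)) (\<lambda>x. x\<^sup>2)"
      using int0[of t] by (subst integrable_distr_eq[OF Z_m]) (simp_all add: Z_def)
    then have "integrable (distr M borel (Z t i)) (\<lambda>x. x\<^sup>2)"
      by (simp only: Z_law)
    then show ?thesis by (subst (asm) integrable_distr_eq[OF Z_m]) simp_all
  qed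
  have Z_var: "expectation (\<lambda>\<omega>. (Z t i \<omega>)\<^sup>2) = t \<bullet> (S *v t)" for t i
  proof -
    have "expectation (\<lambda>\<omega>. (Z t i \<omega>)\<^sup>2) = (\<integral>x. x\<^sup>2 \<partial>distr M borel (Z t i))"
      by (subst integral_distr[OF Z_m]) simp_all
    also have "\<dots> = (\<integral>x. x\<^sup>2 \<partial>distr M borel (Z t 0))" by (simp only: Z_law)
    also have "\<dots> = t \<bullet> (S *v t)"
      by (subst integral_distr[OF Z_m]) (simp_all add: Z_def var0)
    finally show ?thesis .
  qed
  have Z_mean: "expectation (Z t i) = 0" for t i
  proof -
    have "expectation (Z t i) = (\<integral>x. x \<partial>distr M borel (Z t i))"
      by (subst integral_distr[OF Z_m]) simp_all
    also have "\<dots> = (\<integral>x. x \<partial>distr M borel (Z t 0))" by (simp only: Z_law)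
    also have "\<dots> = 0" by (subst integral_distr[OF Z_m]) (simp_all add: Z_def mean0)
    finally show ?thesis .
  qed

  obtain \<nu> :: "(real ^ 'q) measure" where \<nu>: "prob_space \<nu>" "sets \<nu> = sets borel"
    "\<And>t. distr \<nu> borel (\<lambda>x. t \<bullet> x) = normal_law 0 (sqrt (t \<bullet> (S *v t)))"
    using gaussian_exists[OF sym psd] by blast
  define W where "W n \<omega> = (1 / sqrt n) *\<^sub>R (\<Sum>i<n. Y i \<omega>)" for n :: nat and \<omega>
  have W_m: "W n \<in> borel_measurable M" for n unfolding W_def using Y by simp
  have tW: "t \<bullet> W n \<omega> = (\<Sum>i<n. Z t i \<omega>) / sqrt n" for t n \<omega>
    by (simp add: W_def Z_def inner_sum_right)
  define e where "e k = axis k (1 :: real)" for k :: 'q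
  have e: "x $ k = e k \<bullet> x" for k and x :: "real ^ 'q"
    by (simp add: e_def inner_axis')
  have norm_sq: "(norm x)\<^sup>2 = (\<Sum>k\<in>UNIV. (e k \<bullet> x)\<^sup>2)" for x :: "real ^ 'q"
  proof -
    have "(norm x)\<^sup>2 = (\<Sum>k\<in>UNIV. (x $ k)\<^sup>2)"
      unfolding power2_norm_eq_inner inner_vec_def by (simp add: power2_eq_square)
    then show ?thesis by (simp only: e)
  qed
  \<comment> \<open>The trace of \<open>S\<close>, which is the expected squared norm of one
    summand.\<close>
  define C where "C = (\<Sum>k\<in>UNIV. e k \<bullet> (S *v e k))"
  have "weak_conv_laws (\<lambda>n. distr M borel (W n)) \<nu>"
  proof (rule weak_conv_laws_if_char_tendsto[where C = C])
    show "prob_space (distr M borel (W n))" for n by (rule prob_space_distr[OF W_m])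
    show "sets (distr M borel (W n)) = sets borel" for n by simp
    show "prob_space \<nu>" "sets \<nu> = sets borel" by fact+
    \<comment> \<open>Equality holds for positive \<open>n\<close>; the inequality includes
      \<open>n = 0\<close>, where \<open>W n\<close> is 0.\<close>
    have W_sq: "integrable M (\<lambda>\<omega>. (t \<bullet> W n \<omega>)\<^sup>2) \<and> expectation (\<lambda>\<omega>. (t \<bullet> W n \<omega>)\<^sup>2) \<le> t \<bullet> (S *v t)" for t n
      using sum_indep_square[OF Z_indep Z_mean Z_sq Z_var, of t n] psd[of t]
      by (auto simp: tW power_divide)
    show "integrable (distr M borel (W n)) (\<lambda>x. (norm x)\<^sup>2)" for n
      using W_sq by (subst integrable_distr_eq[OF W_m]) (auto simp: norm_sq)
    have "expectation (\<lambda>\<omega>. (norm (W n \<omega>))\<^sup>2) \<le> C" for n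
      unfolding norm_sq C_def using W_sq by (auto intro!: sum_mono)
    then show "(\<integral>x. (norm x)\<^sup>2 \<partial>distr M borel (W n)) \<le> C" for n
      by (subst integral_distr[OF W_m]) auto
    note mom = gaussian_functional_moments[OF \<nu>(2,3) psd]
    show "integrable \<nu> (\<lambda>x. (norm x)\<^sup>2)" unfolding norm_sq using mom by simp
    show "(\<integral>x. (norm x)\<^sup>2 \<partial>\<nu>) \<le> C" unfolding norm_sq C_def using mom by simp
    fix t
    \<comment> \<open>The vector characteristic function at \<open>t\<close> is the scalar one of
      \<open>t \<bullet> W n\<close> at 1.\<close>
    have "(\<integral>x. iexp (t \<bullet> x) \<partial>distr M borel (W n)) =
        char (distr M borel (\<lambda>\<omega>. (\<Sum>i<n. Z t i \<omega>) / sqrt n)) 1" for n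
      using W_m Z_m by (simp add: char_def integral_distr tW del: of_real_divide of_real_sum)
    moreover have "(\<integral>x. iexp (t \<bullet> x) \<partial>\<nu>) = char (normal_law 0 (sqrt (t \<bullet> (S *v t)))) 1"
    proof -
      have "(\<lambda>x. t \<bullet> x) \<in> borel_measurable \<nu>" using \<nu>(2) by (simp cong: measurable_cong_sets)
      then show ?thesis unfolding \<nu>(3)[symmetric] by (simp add: char_def integral_distr)
    qed
    moreover have "(\<lambda>n. char (distr M borel (\<lambda>\<omega>. (\<Sum>i<n. Z t i \<omega>) / sqrt n)) 1)
        \<longlonglongrightarrow> char (normal_law 0 (sqrt (t \<bullet> (S *v t)))) 1"
      using psd[of t] by (intro char_sum_tendsto_normal[OF Z_indep Z_law Z_mean Z_sq]) (simp_all add: Z_var)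
    ultimately show "(\<lambda>n. \<integral>x. iexp (t \<bullet> x) \<partial>distr M borel (W n)) \<longlonglongrightarrow> (\<integral>x. iexp (t \<bullet> x) \<partial>\<nu>)"
      by simp
  qed
  moreover have "centred_normal_law S \<nu>"
    by (rule centred_normal_law_if_functionals[OF sym psd \<nu>])
  ultimately show ?thesis unfolding W_def S_def by blast
qed

subsection \<open>Coordinate moments\<close>

text \<open>An interval is a Borel set, so gluing a function continuous on it to a constant off it
  gives a Borel function.\<close>

lemma borel_measurable_ext_coord:
  assumes "is_interval I" "continuous_on I G"
  shows "ext_coord I G \<in> borel_measurable borel"
proof -
  have "I \<in> sets borel" using assms(1) by (rule real_interval_borel_measurable)
  then show ?thesis
    unfolding ext_coord_def using assms(2) by (intro borel_measurable_continuous_on_if) auto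
qed

theorem theorem6p1:
  fixes I :: "real set" and G :: "real \<Rightarrow> real"
    and M :: "'a measure" and P :: "real measure"
    and X U :: "nat \<Rightarrow> 'a \<Rightarrow> real"  \<comment> \<open>index 0: the generic copy; indices 1, 2, ...: the sample\<close>
    and p :: "nat \<Rightarrow> real" and phat :: "nat \<Rightarrow> nat \<Rightarrow> 'a \<Rightarrow> real"
    and q :: nat and idx :: "'q::finite \<Rightarrow> nat"  \<comment> \<open>numbering of the coordinates of \<open>real ^ 'q\<close>\<close>
  assumes interval: "is_interval I"
    and G_cont: "continuous_on I G"
    and G_mono: "strict_mono_on I G"
    and G_bij: "bij_betw G I {0<..<1}"
    and M: "prob_space M"
    and indep: "prob_space.indep_vars M (\<lambda>_. borel) X UNIV"
    and law: "\<And>i. distr M borel (X i) = P"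
    and P_I: "measure P I = 1"
    and U: "\<And>i \<omega>. U i \<omega> = ext_coord I G (X i \<omega>)"
    and p: "\<And>r. r \<ge> 1 \<Longrightarrow> p r = (\<integral>\<omega>. U 0 \<omega> ^ r \<partial>M)"
    and phat: "\<And>n r \<omega>. phat n r \<omega> = (1 / real n) * (\<Sum>i = 1..n. U i \<omega> ^ r)"
    and q: "q \<ge> 1"
    and idx: "bij_betw idx UNIV {1..q}"
  shows "(\<exists>\<nu> :: (real ^ 'q) measure.
            centred_normal_law
              (\<chi> i j. covar M (\<lambda>\<omega>. U 0 \<omega> ^ idx i) (\<lambda>\<omega>. U 0 \<omega> ^ idx j)) \<nu> \<and>
            weak_conv_laws
              (\<lambda>n. distr M borel (\<lambda>\<omega>. sqrt (real n) *\<^sub>R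
                 ((\<chi> k. phat n (idx k) \<omega>) - (\<chi> k. p (idx k))))) \<nu>) \<and>
         (\<forall>r \<in> {1..q}. \<forall>s \<in> {1..q}.
            covar M (\<lambda>\<omega>. U 0 \<omega> ^ r) (\<lambda>\<omega>. U 0 \<omega> ^ s) = p (r + s) - p r * p s)"
proof -
  interpret prob_space M by fact
  define u where "u = ext_coord I G"
  have u_m: "u \<in> borel_measurable borel"
    unfolding u_def by (rule borel_measurable_ext_coord[OF interval G_cont])
  \<comment> \<open>The value 0 off \<open>I\<close> keeps these bounds on the whole line, so all
    powers of \<open>U i\<close> are bounded and integrable.\<close>
  have u01: "0 \<le> u x \<and> u x \<le> 1" for x
    using bij_betwE[OF G_bij] by (force simp: u_def ext_coord_def)
  have X: "X i \<in> borel_measurable M" for i using indep by (simp add: indep_vars_def)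
  have Uu: "U i = (\<lambda>\<omega>. u (X i \<omega>))" for i by (simp add: fun_eq_iff U u_def)
  have U_m: "U i \<in> borel_measurable M" for i
    unfolding Uu by (rule measurable_compose[OF X u_m])
  have U_bd: "0 \<le> U i \<omega>" "U i \<omega> \<le> 1" for i \<omega> using u01 by (simp_all add: Uu)
  have U_int: "integrable M (\<lambda>\<omega>. U i \<omega> ^ r)" for i r
    using U_m U_bd by (intro integrable_const_bound[of _ 1]) (auto simp: power_le_one)
  \<comment> \<open>The moments \<open>p\<close> refer to the generic copy \<open>U 0\<close>, the
    sample to indices from 1 on; the common law \<open>P\<close> links them.\<close>
  have U_law: "expectation (\<lambda>\<omega>. h (U i \<omega>)) = expectation (\<lambda>\<omega>. h (U 0 \<omega>))"
    if "h \<in> borel_measurable borel" for h :: "real \<Rightarrow> real" and i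
  proof -
    have "expectation (\<lambda>\<omega>. h (U j \<omega>)) = (\<integral>x. h (u x) \<partial>P)" for j
      unfolding law[of j, symmetric] Uu
      by (rule integral_distr[symmetric, OF X measurable_compose[OF u_m that]])
    then show ?thesis by simp
  qed
  have cov: "covar M (\<lambda>\<omega>. U 0 \<omega> ^ r) (\<lambda>\<omega>. U 0 \<omega> ^ s) =
      expectation (\<lambda>\<omega>. (U 0 \<omega> ^ r - p r) * (U 0 \<omega> ^ s - p s))" if "1 \<le> r" "1 \<le> s" for r s
    using that by (simp add: covar_def p)
  have idx1: "1 \<le> idx k" for k using bij_betwE[OF idx] by auto

  \<comment> \<open>Centred power vectors, shifted by one so that summing over \<open>i<n\<close>
    runs through the sample \<open>1..n\<close>.\<close>
  define Y :: "nat \<Rightarrow> 'a \<Rightarrow> real ^ 'q" where "Y i \<omega> = (\<chi> k. u (X (Suc i) \<omega>) ^ idx k - p (idx k))" for i \<omega>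
  have y_m: "(\<lambda>x. \<chi> k. u x ^ idx k - p (idx k)) \<in> borel_measurable borel"
    using u_m by (intro borel_measurable_vec_lambda) simp
  have "indep_vars (\<lambda>_. borel) (\<lambda>i. X (Suc i)) UNIV"
    by (rule indep_vars_inj_reindex[OF indep]) simp
  then have Y_indep: "indep_vars (\<lambda>_. borel) Y UNIV"
    unfolding Y_def[abs_def] by (rule indep_vars_compose2) (rule y_m)
  have Y_law: "distr M borel (Y i) = distr P borel (\<lambda>x. \<chi> k. u x ^ idx k - p (idx k))" for i
    unfolding law[of "Suc i", symmetric] using X y_m
    by (subst distr_distr) (simp_all add: comp_def Y_def[abs_def])
  have Yk: "Y i \<omega> $ k = U (Suc i) \<omega> ^ idx k - p (idx k)" for i \<omega> k
    by (simp add: Y_def Uu)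
  have "expectation (\<lambda>\<omega>. Y 0 \<omega> $ k) = 0" for k
    using U_int U_law[of "\<lambda>x. x ^ idx k" 1] p[OF idx1] by (simp add: Yk prob_space)
  moreover have "integrable M (\<lambda>\<omega>. (Y 0 \<omega> $ k)\<^sup>2)" for k
    using U_int by (simp add: Yk power2_diff power_mult[symmetric])
  ultimately obtain \<nu> where \<nu>:
    "centred_normal_law (\<chi> i j. expectation (\<lambda>\<omega>. Y 0 \<omega> $ i * Y 0 \<omega> $ j)) \<nu>"
    "weak_conv_laws (\<lambda>n. distr M borel (\<lambda>\<omega>. (1 / sqrt n) *\<^sub>R (\<Sum>i<n. Y i \<omega>))) \<nu>"
    using multivariate_central_limit_theorem[OF Y_indep Y_law] by blast
  have "expectation (\<lambda>\<omega>. Y 0 \<omega> $ i * Y 0 \<omega> $ j) =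
      covar M (\<lambda>\<omega>. U 0 \<omega> ^ idx i) (\<lambda>\<omega>. U 0 \<omega> ^ idx j)" for i j
    unfolding cov[OF idx1 idx1] Yk
    by (rule U_law[of "\<lambda>x. (x ^ idx i - p (idx i)) * (x ^ idx j - p (idx j))"]) measurable
  moreover have "(1 / sqrt n) *\<^sub>R (\<Sum>i<n. Y i \<omega>) =
      sqrt n *\<^sub>R ((\<chi> k. phat n (idx k) \<omega>) - (\<chi> k. p (idx k)))" for n \<omega>
  \<comment> \<open>For \<open>n = 0\<close> both sides are 0; otherwise
    \<open>n / sqrt n = sqrt n\<close> converts the normalised sum into the scaled deviation of the
    mean.\<close>
  proof (cases "n = 0")
    case False
    have "(1 / sqrt n) * (\<Sum>i<n. U (Suc i) \<omega> ^ r - p r) = sqrt n * (phat n r \<omega> - p r)" for r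
    proof -
      have "(\<Sum>i<n. U (Suc i) \<omega> ^ r) = (\<Sum>i = 1..n. U i \<omega> ^ r)"
        by (rule sum.reindex_bij_witness[of _ "\<lambda>i. i - 1" Suc]) auto
      then have "(\<Sum>i<n. U (Suc i) \<omega> ^ r - p r) = n * (phat n r \<omega> - p r)"
        using False by (simp add: phat sum_subtractf algebra_simps)
      then have "(1 / sqrt n) * (\<Sum>i<n. U (Suc i) \<omega> ^ r - p r) = n / sqrt n * (phat n r \<omega> - p r)"
        by simp
      then show ?thesis by (simp only: real_div_sqrt of_nat_0_le_iff)
    qed
    then show ?thesis by (simp add: vec_eq_iff Yk)
  qed simp
  ultimately have "\<exists>\<nu> :: (real ^ 'q) measure.
      centred_normal_law
        (\<chi> i j. covar M (\<lambda>\<omega>. U 0 \<omega> ^ idx i) (\<lambda>\<omega>. U 0 \<omega> ^ idx j)) \<nu> \<and>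
      weak_conv_laws
        (\<lambda>n. distr M borel (\<lambda>\<omega>. sqrt (real n) *\<^sub>R
           ((\<chi> k. phat n (idx k) \<omega>) - (\<chi> k. p (idx k))))) \<nu>"
    using \<nu> by auto
  moreover have "covar M (\<lambda>\<omega>. U 0 \<omega> ^ r) (\<lambda>\<omega>. U 0 \<omega> ^ s) = p (r + s) - p r * p s"
    if "1 \<le> r" "1 \<le> s" for r s
  proof -
    \<comment> \<open>After integration each of the two mixed terms contributes
      \<open>- p r * p s\<close>, and the constant cancels one of them.\<close>
    have "(\<lambda>\<omega>. (U 0 \<omega> ^ r - p r) * (U 0 \<omega> ^ s - p s)) =
        (\<lambda>\<omega>. U 0 \<omega> ^ (r + s) - p s * U 0 \<omega> ^ r - p r * U 0 \<omega> ^ s + p r * p s)"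
      by (simp add: fun_eq_iff power_add algebra_simps)
    moreover have "p (r + s) = expectation (\<lambda>\<omega>. U 0 \<omega> ^ (r + s))" "p r = expectation (\<lambda>\<omega>. U 0 \<omega> ^ r)"
      "p s = expectation (\<lambda>\<omega>. U 0 \<omega> ^ s)" using that by (simp_all add: p)
    ultimately show ?thesis
      unfolding cov[OF that] using U_int by (simp add: prob_space)
  qed
  ultimately show ?thesis by auto
qed

end
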